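(* Let $p>3$ be a prime and let $k$ be a positive integer. Consider the triangle group $\Delta(2,k,p)=\langle x,y\mid x^2=y^k=(xy)^p=1\rangle$ acting on $\mathbb{F}_p\cup\{\infty\}$ via $\mathrm{PSL}(2,p)$ (the transformations induced by $x,y$ being again denoted $x,y$), in such a way that $xy$ is the transformation $z\mapsto z+1$. Let $t$ be an involution in $\mathrm{PGL}(2,p)$ such that $t^{-1}xt=x^{-1}$ and $t^{-1}yt=y^{-1}$, and suppose that the resulting associate coset diagram, found by replacing $x$ by $xt$ (i.e. the coset diagram for the action on $\mathbb{F}_p\cup\{\infty\}$ given by the pair $(xt,y)$), yields a $k$-januarial for $\mathrm{PSL}(2,p)$ or $\mathrm{PGL}(2,p)$, depending on whether or not $t$ lies in $\mathrm{PSL}(2,p)$. Then: (a) if $k=3$, then $p\equiv 13$ or $17 \pmod{20}$; (b) if $k=4$, then $p\equiv 17$ or $19 \pmod{24}$; (c) if $k=6$, then $p\equiv 13$, $19$ or $31 \pmod{42}$.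
   Context: $\mathrm{PGL}(2,p)$ and its subgroup $\mathrm{PSL}(2,p)$ act on the projective line $\mathbb{F}_p\cup\{\infty\}$ by Möbius transformations: the class of $\begin{pmatrix} a&b\\c&d\end{pmatrix}$ acts as $z\mapsto (az+c)/(bz+d)$, with products of transformations read from left to right. Januarials: let $X,Y$ be permutations of a finite set $S$ with $X^2=Y^k=(XY)^l=1$ for some positive integer $l$, so that the triangle group $\Delta(2,k,l)=\langle x,y\mid x^2=y^k=(xy)^l=1\rangle$ acts on $S$ via $x\mapsto X$, $y\mapsto Y$; the action is taken to be transitive. The corresponding coset diagram is the graph with vertex set $S$, with an $x$-edge from $u$ to $u^X$ and a $y$-edge from $u$ to $u^Y$ for each $u\in S$ (the two $x$-edges coming from each 2-cycle of $X$ being identified to a single unoriented edge). Attaching a 2-cell along each $x$-loop, a polygon around each orbit of $\langle Y\rangle$ and a polygon around each orbit of $\langle XY\rangle$ gives a closed orientable surface. This is a $k$-januarial if $\langle XY\rangle$ has exactly two orbits on $S$, both of size $|S|/2$, and the coset diagram is then said to yield a $k$-januarial. For the associate, $S=\mathbb{F}_p\cup\{\infty\}$, $X=xt$ (note $(xt)^2=1$) and $Y=y$.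
   Formalization: The transformation y is additionally required to have order exactly k, not merely to satisfy y^k=1; without this, (c) fails for p=17, k=6 with x: z↦-1/z, y: z↦1-1/z (of order 3) and t: z↦1/z. *)

theory Defs
  imports
    "HOL-Analysis.Determinants"
    "HOL-Combinatorics.Orbits"
    "HOL-Algebra.Bij"
    "HOL-Algebra.Generated_Groups"
    "HOL-Number_Theory.Cong"
begin

(* Products of transformations are read from left to right: f \<circ>> g is f followed by g. *)
notation fcomp (infixl "\<circ>>" 60)

(* The projective line over a field 'a is 'a option, with None as the point at infinity.
   The matrix with rows (a, b) and (c, d) acts by z \<mapsto> (a z + c) / (b z + d), that is, by right
   multiplication on the row vectors (z, 1), which makes it compatible with left-to-right
   products (see mobius_mult). *)
definition mobius :: "'a::field ^ 2 ^ 2 \<Rightarrow> 'a option \<Rightarrow> 'a option" where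
  "mobius A u =
    (let a = A $ 1 $ 1; b = A $ 1 $ 2; c = A $ 2 $ 1; d = A $ 2 $ 2 in
     case u of
       None \<Rightarrow> (if b = 0 then None else Some (a / b))
     | Some z \<Rightarrow> (if b * z + d = 0 then None else Some ((a * z + c) / (b * z + d))))"

(* Elements of the projective groups are identified with the transformations they induce;
   this is legitimate since two invertible matrices induce the same transformation exactly
   if they agree up to a nonzero scalar (see mobius_eq_iff). *)
definition PGL2 :: "('a::field option \<Rightarrow> 'a option) set" where
  "PGL2 = mobius ` {A. det A \<noteq> 0}"

definition PSL2 :: "('a::field option \<Rightarrow> 'a option) set" where
  "PSL2 = mobius ` {A. det A = 1}"

lemma mobius_mult:
  assumes "det A \<noteq> 0" "det B \<noteq> 0"
  shows "mobius (A ** B) = mobius A \<circ>> mobius B"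
proof
  fix u
  define a b c d where "a = A $ 1 $ 1" and "b = A $ 1 $ 2" and "c = A $ 2 $ 1" and "d = A $ 2 $ 2"
  define a' b' c' d' where "a' = B $ 1 $ 1" and "b' = B $ 1 $ 2" and "c' = B $ 2 $ 1" and "d' = B $ 2 $ 2"
  note defs = a_def b_def c_def d_def a'_def b'_def c'_def d'_def
  have detA: "a * d - b * c \<noteq> 0" and detB: "a' * d' - b' * c' \<noteq> 0"
    using assms by (simp_all add: det_2 defs)
  have AB: "(A ** B) $ 1 $ 1 = a * a' + b * c'" "(A ** B) $ 1 $ 2 = a * b' + b * d'"
     "(A ** B) $ 2 $ 1 = c * a' + d * c'" "(A ** B) $ 2 $ 2 = c * b' + d * d'"
    by (simp_all add: matrix_matrix_mult_def sum_2 defs)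
  have step: "(if n * b' + m * d' = 0 then None else Some ((n * a' + m * c') / (n * b' + m * d')))
     = mobius B (if m = 0 then None else Some (n / m))" if "n \<noteq> 0 \<or> m \<noteq> 0" for n m
  proof (cases "m = 0")
    case True
    then show ?thesis using that by (simp add: mobius_def Let_def flip: a'_def b'_def c'_def d'_def)
  next
    case False
    then have "b' * (n / m) + d' = (n * b' + m * d') / m" "a' * (n / m) + c' = (n * a' + m * c') / m"
      by (simp_all add: field_simps)
    then show ?thesis using False
      by (simp add: mobius_def Let_def flip: a'_def b'_def c'_def d'_def)
  qed
  show "mobius (A ** B) u = (mobius A \<circ>> mobius B) u"
  proof (cases u)
    case None
    have "a \<noteq> 0 \<or> b \<noteq> 0" using detA by auto
    from step[OF this] show ?thesis
      unfolding None fcomp_apply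
      by (simp add: mobius_def[of "A ** B"] mobius_def[of A] Let_def AB flip: a_def b_def c_def d_def)
  next
    case (Some z)
    have *: "a * z + c \<noteq> 0 \<or> b * z + d \<noteq> 0"
    proof (rule ccontr)
      assume "\<not> ?thesis"
      then have c: "c = - a * z" and d: "d = - b * z" by (simp_all add: eq_neg_iff_add_eq_0 add.commute)
      show False using detA unfolding c d by (simp add: algebra_simps)
    qed
    have dist: "(a * a' + b * c') * z + (c * a' + d * c') = (a * z + c) * a' + (b * z + d) * c'"
      "(a * b' + b * d') * z + (c * b' + d * d') = (a * z + c) * b' + (b * z + d) * d'"
      by (simp_all add: algebra_simps)
    from step[OF *] show ?thesis
      unfolding Some fcomp_apply
      by (simp add: mobius_def[of "A ** B"] mobius_def[of A] Let_def AB dist flip: a_def b_def c_def d_def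
            split del: if_split cong: if_cong)
  qed
qed

lemma mobius_eq_iff:
  assumes "det A \<noteq> 0" "det B \<noteq> 0"
  shows "mobius A = mobius B \<longleftrightarrow> (\<exists>r. r \<noteq> 0 \<and> A = (\<chi> i j. r * B $ i $ j))"
proof
  assume "\<exists>r. r \<noteq> 0 \<and> A = (\<chi> i j. r * B $ i $ j)"
  then obtain r where r: "r \<noteq> 0" and A: "A = (\<chi> i j. r * B $ i $ j)" by blast
  have e: "r * b * z + r * d = r * (b * z + d)" for b d z by (simp add: algebra_simps)
  show "mobius A = mobius B"
    by (rule ext) (simp add: A mobius_def Let_def r e split: option.split)
next
  assume eq: "mobius A = mobius B"
  define a b c d where "a = A $ 1 $ 1" and "b = A $ 1 $ 2" and "c = A $ 2 $ 1" and "d = A $ 2 $ 2"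
  define a' b' c' d' where "a' = B $ 1 $ 1" and "b' = B $ 1 $ 2" and "c' = B $ 2 $ 1" and "d' = B $ 2 $ 2"
  note defs = a_def b_def c_def d_def a'_def b'_def c'_def d'_def
  have detA: "a * d - b * c \<noteq> 0" and detB: "a' * d' - b' * c' \<noteq> 0"
    using assms by (simp_all add: det_2 defs)
  have frac: "n * m' = n' * m"
    if "(if m = 0 then None else Some (n / m)) = (if m' = 0 then None else Some (n' / m'))"
    for n m n' m' :: 'a
    using that by (auto simp: frac_eq_eq split: if_splits)
  have 1: "a * b' = a' * b"
    using fun_cong[OF eq, of None]
    by (intro frac) (simp add: mobius_def Let_def flip: defs)
  have 2: "c * d' = c' * d"
    using fun_cong[OF eq, of "Some 0"]
    by (intro frac) (simp add: mobius_def Let_def cong: if_cong flip: defs)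
  have "(a + c) * (b' + d') = (a' + c') * (b + d)"
    using fun_cong[OF eq, of "Some 1"]
    by (intro frac) (simp add: mobius_def Let_def cong: if_cong flip: defs)
  then have 3: "a * d' + c * b' = a' * d + c' * b"
    using 1 2 by (simp add: algebra_simps)
  define e s where "e = a' * d' - b' * c'" and "s = a * d' - b * c'"
  have e: "e \<noteq> 0" using detB by (simp add: e_def)
  have s: "s = a' * d - c * b'" using 3 by (simp add: s_def algebra_simps)
  have "a * e = s * a'" "b * e = s * b'"
    using 1 unfolding e_def s_def by algebra+
  moreover have "c * e = s * c'" "d * e = s * d'"
    using 2 unfolding e_def s by algebra+
  ultimately have main: "a = s / e * a'" "b = s / e * b'" "c = s / e * c'" "d = s / e * d'"
    using e by (simp_all add: field_simps)
  have "s / e \<noteq> 0"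
    using main detA by auto
  with main have "s / e \<noteq> 0 \<and> A = (\<chi> i j. s / e * B $ i $ j)"
    by (simp add: vec_eq_iff forall_2 defs)
  then show "\<exists>r. r \<noteq> 0 \<and> A = (\<chi> i j. r * B $ i $ j)" ..
qed

(* x \<mapsto> X, y \<mapsto> Y defines an action of the triangle group with presentation
   (x, y | x^2 = y^k = (xy)^l = 1). As in that presentation, the relations
   only bound the orders of X, Y and XY up to divisibility; that Y has order exactly k
   has to be required separately where it is meant. *)
definition triangle_action :: "nat \<Rightarrow> nat \<Rightarrow> ('s \<Rightarrow> 's) \<Rightarrow> ('s \<Rightarrow> 's) \<Rightarrow> bool" where
  "triangle_action k l X Y \<longleftrightarrow>
    bij X \<and> bij Y \<and> X ^^ 2 = id \<and> Y ^^ k = id \<and> (X \<circ>> Y) ^^ l = id"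

(* BijGroup composes from right to left, which does not affect generated subgroups. *)
definition perm_group :: "('s \<Rightarrow> 's) \<Rightarrow> ('s \<Rightarrow> 's) \<Rightarrow> ('s \<Rightarrow> 's) set" where
  "perm_group X Y = generate (BijGroup UNIV) {X, Y}"

(* The coset diagram of the pair (X, Y), with vertex set the finite type 's, yields a
   k-januarial. For a permutation f of a finite set, orbit f u is the orbit of u under the
   cyclic group generated by f. *)
definition januarial :: "nat \<Rightarrow> ('s::finite \<Rightarrow> 's) \<Rightarrow> ('s \<Rightarrow> 's) \<Rightarrow> bool" where
  "januarial k X Y \<longleftrightarrow>
    (\<exists>l>0. triangle_action k l X Y) \<and>
    (\<forall>u v. \<exists>g\<in>perm_group X Y. g u = v) \<and>
    card (range (orbit (X \<circ>> Y))) = 2 \<and>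
    (\<forall>C\<in>range (orbit (X \<circ>> Y)). 2 * card C = CARD('s))"

(* A k-januarial for the group G: the permutations X and Y generate G. *)
definition januarial_for :: "('s::finite \<Rightarrow> 's) set \<Rightarrow> nat \<Rightarrow> ('s \<Rightarrow> 's) \<Rightarrow> ('s \<Rightarrow> 's) \<Rightarrow> bool" where
  "januarial_for G k X Y \<longleftrightarrow> januarial k X Y \<and> perm_group X Y = G"

end

theory Submission
  imports Defs "HOL-Computational_Algebra.Polynomial" "HOL-Number_Theory.Quadratic_Reciprocity"
begin

text \<open>
  Let \<open>b\<close> be the trace of the matrix \<open>X T\<close> of \<open>y\<close>, where \<open>X\<close> has determinant 1 and trace 0 and \<open>T\<close>
  is the translation. The condition that \<open>t\<close> inverts \<open>x\<close> and \<open>y\<close> says that \<open>t\<close>, \<open>xt\<close> and \<open>yt\<close> are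
  involutions, i.e. that their matrices have trace 0; this determines the matrix \<open>M\<close> of \<open>t\<close> up to a
  scalar. Now \<open>xty = t(xy)\<close> has the matrix \<open>M T\<close>, with trace \<open>\<beta>\<close>, determinant \<open>\<delta> = - (\<beta> / b)\<^sup>2\<close> and
  discriminant \<open>(\<beta> / b)\<^sup>2 (b\<^sup>2 + 4)\<close>.

  Two orbits of size \<open>(p + 1) / 2\<close> mean that \<open>M T\<close> has no fixed point, so \<open>b\<^sup>2 + 4\<close> is not a square,
  and that its power of exponent \<open>(p + 1) / 2\<close> is a scalar \<open>c\<close>. As the Frobenius map exchanges the
  eigenvalues, the power of exponent \<open>p + 1\<close> is \<open>\<delta>\<close>. So \<open>\<delta> = c\<^sup>2\<close>, hence \<open>-1\<close> is a square and
  \<open>p \<equiv> 1\<close> modulo 4. Finally \<open>b\<^sup>2\<close> is 1, 2, 3 for \<open>k\<close> = 3, 4, 6, and quadratic reciprocity translates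
  the conditions on \<open>b\<^sup>2\<close> and \<open>b\<^sup>2 + 4\<close> (5, 6, 7, respectively) into congruences.
\<close>

subsection \<open>Squares in prime fields\<close>

lemma CHAR_eq_CARD:
  assumes "prime CARD('a::{field,finite})"
  shows "CHAR('a) = CARD('a)"
  using assms CHAR_dvd_CARD[where ?'a = 'a] CHAR_not_1'[where ?'a = 'a]
  by (metis One_nat_def prime_nat_iff)

text \<open>By counting, since the residues below the characteristic have distinct images. Every
  field element thus lifts to an integer, which transfers number theory modulo
  \<open>CARD('a)\<close> to the field.\<close>

lemma surj_of_int_prime_CARD:
  assumes "prime CARD('a::{field,finite})"
  shows "surj (of_int :: int \<Rightarrow> 'a)"
proof -
  have "inj_on (of_nat :: nat \<Rightarrow> 'a) {..<CARD('a)}"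
    by (auto intro!: inj_onI simp: of_nat_eq_iff_cong_CHAR CHAR_eq_CARD[OF assms] cong_def)
  then have "of_nat ` {..<CARD('a)} = (UNIV :: 'a set)"
    by (intro card_subset_eq) (simp_all add: card_image)
  then have "x \<in> range (of_int :: int \<Rightarrow> 'a)" for x
    by (metis UNIV_I imageE of_int_of_nat_eq rangeI)
  then show ?thesis by blast
qed

lemma QuadRes_imp_square:
  assumes "prime CARD('a::{field,finite})" and "QuadRes (int CARD('a)) n"
  shows "\<exists>s::'a. s\<^sup>2 = of_int n"
proof -
  obtain m where "[m\<^sup>2 = n] (mod int CARD('a))"
    using assms(2) by (auto simp: QuadRes_def)
  then have "of_int (m\<^sup>2) = (of_int n :: 'a)"
    by (simp only: of_int_eq_iff_cong_CHAR CHAR_eq_CARD[OF assms(1)])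
  then show ?thesis by (metis of_int_power)
qed

lemma euler_criterion_field:
  fixes D :: "'a::{field,finite}"
  assumes "prime CARD('a)" and "CARD('a) > 2" and "\<nexists>s. s\<^sup>2 = D"
  shows "D ^ ((CARD('a) - 1) div 2) = -1"
proof -
  obtain d where D: "D = of_int d"
    using surj_of_int_prime_CARD[OF assms(1)] by blast
  have "\<not> QuadRes (int CARD('a)) d"
    using QuadRes_imp_square[OF assms(1)] assms(3) D by blast
  moreover have "\<not> [d = 0] (mod int CARD('a))"
    using assms(3) D of_int_eq_iff_cong_CHAR[where ?'a = 'a, of d 0] CHAR_eq_CARD[OF assms(1)]
    by (metis of_int_0 power_zero_numeral)
  ultimately have "[- 1 = d ^ ((CARD('a) - 1) div 2)] (mod int CARD('a))"
    using euler_criterion[of "CARD('a)" d] assms by (simp add: Legendre_def)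
  then have "of_int (- 1) = (of_int (d ^ ((CARD('a) - 1) div 2)) :: 'a)"
    by (simp only: of_int_eq_iff_cong_CHAR CHAR_eq_CARD[OF assms(1)])
  then show ?thesis by (simp add: D)
qed

lemma power_CARD_minus_1:
  fixes x :: "'a::{field,finite}"
  assumes "prime CARD('a)" and "x \<noteq> 0"
  shows "x ^ (CARD('a) - 1) = 1"
proof -
  obtain n where x: "x = of_int n"
    using surj_of_int_prime_CARD[OF assms(1)] by blast
  have nd: "\<not> int CARD('a) dvd n"
    using assms(2) x of_int_eq_0_iff_char_dvd[where ?'a = 'a, of n] CHAR_eq_CARD[OF assms(1)] by simp
  define m where "m = nat (n mod int CARD('a))"
  have m: "[int m = n] (mod int CARD('a))"
    by (simp add: m_def cong_def)
  then have "\<not> CARD('a) dvd m"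
    using nd by (metis cong_dvd_iff int_dvd_int_iff)
  then have "[m ^ (CARD('a) - 1) = 1] (mod CARD('a))"
    by (rule fermat_theorem[OF assms(1)])
  then have "of_nat (m ^ (CARD('a) - 1)) = (of_nat 1 :: 'a)"
    by (simp only: of_nat_eq_iff_cong_CHAR CHAR_eq_CARD[OF assms(1)])
  moreover have "x = of_nat m"
    using m unfolding x by (metis CHAR_eq_CARD[OF assms(1)] of_int_eq_iff_cong_CHAR of_int_of_nat_eq)
  ultimately show ?thesis by simp
qed

lemma odd_CARD_two_neq_0:
  assumes "prime CARD('a::{field,finite})" and "CARD('a) > 2"
  shows "(2::'a) \<noteq> 0"
  using assms of_nat_eq_0_iff_char_dvd[where ?'a = 'a, of 2] CHAR_eq_CARD[OF assms(1)]
  by (auto dest: dvd_imp_le)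

text \<open>Otherwise \<open>CARD('a) - 1\<close> is twice an odd number, so \<open>i\<close> raised
  to it is an odd power of -1, against Fermat.\<close>

lemma minus_1_square_imp:
  fixes i :: "'a::{field,finite}"
  assumes "prime CARD('a)" and "CARD('a) > 2" and "i\<^sup>2 = -1"
  shows "CARD('a) mod 4 = 1"
proof (rule ccontr)
  assume "CARD('a) mod 4 \<noteq> 1"
  moreover have "odd CARD('a)"
    using assms prime_odd_nat by blast
  ultimately have "CARD('a) = 4 * (CARD('a) div 4) + 3"
    by presburger
  then obtain q where q: "CARD('a) = 4 * q + 3" ..
  have "CARD('a) - 1 = 2 * (2 * q + 1)"
    using q by simp
  then have "i ^ (CARD('a) - 1) = (i\<^sup>2) ^ (2 * q + 1)"
    by (simp only: power_mult)
  also have "\<dots> = -1"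
    unfolding assms(3) by simp
  finally have "(1::'a) = -1"
    using power_CARD_minus_1[OF assms(1), of i] assms(3) by fastforce
  then show False
    using odd_CARD_two_neq_0[OF assms(1,2)] by (metis one_add_one add.right_inverse)
qed

text \<open>Since \<open>(1 + i)\<^sup>2 = 2 * i\<close>, the quotient \<open>(1 + i) / b\<close>
  squares to \<open>i\<close>: it is a primitive eighth root of unity, so 8 divides the order of the
  multiplicative group.\<close>

lemma two_square_imp_mod_8:
  fixes b i :: "'a::{field,finite}"
  assumes "prime CARD('a)" "CARD('a) > 2" and "b\<^sup>2 = 2" "i\<^sup>2 = -1"
  shows "CARD('a) mod 8 = 1"
proof (rule ccontr)
  assume *: "CARD('a) mod 8 \<noteq> 1"
  have two: "(2::'a) \<noteq> 0"
    by (rule odd_CARD_two_neq_0[OF assms(1,2)])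
  define z where "z = (1 + i) / b"
  have "(1 + i)\<^sup>2 = 2 * i"
    using assms(4) by (simp add: power2_sum)
  then have "z\<^sup>2 = i"
    using two assms(3) by (simp add: z_def power_divide)
  then have z4: "z ^ 4 = -1"
    using assms(4) power_mult[of z 2 2] by simp
  have "CARD('a) mod 4 = 1"
    by (rule minus_1_square_imp[OF assms(1,2,4)])
  with * have "CARD('a) = 8 * (CARD('a) div 8) + 5"
    by presburger
  then have "CARD('a) - 1 = 4 * (2 * (CARD('a) div 8) + 1)"
    by simp
  then have "z ^ (CARD('a) - 1) = -1"
    by (simp only: power_mult z4) simp
  moreover have "z \<noteq> 0"
    using z4 by auto
  ultimately have "(1::'a) = -1"
    using power_CARD_minus_1[OF assms(1)] by metis
  then show False
    using two by (metis one_add_one add.right_inverse)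
qed

text \<open>\<open>i * b\<close> is a square root of -3, so the field contains a primitive cube root
  of unity, and 3 divides \<open>CARD('a) - 1\<close>.\<close>

lemma three_square_imp_mod_3:
  fixes b i :: "'a::{field,finite}"
  assumes "prime CARD('a)" "CARD('a) > 3" and "b\<^sup>2 = 3" "i\<^sup>2 = -1"
  shows "CARD('a) mod 3 = 1"
proof (rule ccontr)
  assume *: "CARD('a) mod 3 \<noteq> 1"
  have two: "(2::'a) \<noteq> 0"
    using assms by (intro odd_CARD_two_neq_0) auto
  have "b \<noteq> 0"
  proof
    assume "b = 0"
    then have "of_nat 3 = (0::'a)"
      using assms(3) by simp
    then have "CARD('a) dvd 3"
      unfolding of_nat_eq_0_iff_char_dvd CHAR_eq_CARD[OF assms(1)] .
    then show False
      using assms(2) by (auto dest: dvd_imp_le)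
  qed
  define s where "s = i * b"
  have s: "s\<^sup>2 = -3"
    by (simp add: s_def power_mult_distrib assms(3,4))
  define z where "z = (s - 1) / 2"
  have z: "2 * z + 1 = s"
    by (simp only: z_def times_divide_eq_right nonzero_mult_div_cancel_left[OF two] diff_add_cancel)
  have "2 * 2 * (z\<^sup>2 + z + 1) = (2 * z + 1)\<^sup>2 + 3"
    by (simp add: power2_eq_square algebra_simps)
  also have "\<dots> = 0"
    unfolding z s by simp
  finally have zz: "z\<^sup>2 + z + 1 = 0"
    using two unfolding mult_eq_0_iff by blast
  then have z0: "z \<noteq> 0"
    by auto
  have "z ^ 3 - 1 = (z - 1) * (z\<^sup>2 + z + 1)"
    by (simp add: power2_eq_square power3_eq_cube algebra_simps)
  then have z3: "z ^ 3 = 1"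
    unfolding zz by simp
  have "CARD('a) mod 3 \<noteq> 0"
    using assms(1,2) primes_dvd_imp_eq[of 3 "CARD('a)"] by (auto simp: dvd_eq_mod_eq_0)
  with * have "CARD('a) = 3 * (CARD('a) div 3) + 2"
    by presburger
  then have "CARD('a) - 1 = Suc (3 * (CARD('a) div 3))"
    by simp
  then have "z ^ (CARD('a) - 1) = z"
    by (simp only: power_Suc power_mult z3) simp
  then have "z = 1"
    using power_CARD_minus_1[OF assms(1) z0] by simp
  \<comment> \<open>Now -3 = 9, so 12 vanishes, which fails in characteristic above 3.\<close>
  then have "s\<^sup>2 = 3\<^sup>2"
    using z by simp
  then have "2 * 2 * b\<^sup>2 = 0"
    unfolding s assms(3) by (simp add: minus_equation_iff[of 3] eq_neg_iff_add_eq_0)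
  then show False
    using two \<open>b \<noteq> 0\<close> by (simp only: mult_eq_0_iff power_eq_0_iff) simp
qed

section \<open>Quadratic reciprocity and residues modulo small primes\<close>

lemma QuadRes_reciprocity:
  assumes "prime p" "p > 2" "prime q" "q > 2" "p \<noteq> q" "p mod 4 = 1"
    and "QuadRes (int q) (int p)"
  shows "QuadRes (int p) (int q)"
proof -
  have "\<not> [int p = 0] (mod int q)" "\<not> [int q = 0] (mod int p)"
    using assms(1,3,5) by (auto simp: cong_0_iff dest: primes_dvd_imp_eq)
  moreover have "even ((p - 1) div 2)"
    using assms(6) by presburger
  then have "Legendre (int p) (int q) * Legendre (int q) (int p) = 1"
    using Quadratic_Reciprocity[OF assms(1-5)] by simp
  ultimately show ?thesis
    using assms(7) by (auto simp: Legendre_def split: if_splits)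
qed

text \<open>Contraposition of reciprocity, which is symmetric because \<open>CARD('a)\<close> is 1
  modulo 4. It turns a nonsquare of the field into a condition on the residue of
  \<open>CARD('a)\<close> modulo the fixed prime \<open>q\<close>.\<close>

lemma nonsquare_imp_not_QuadRes:
  assumes "prime CARD('a::{field,finite})" "CARD('a) mod 4 = 1" "prime q" "q > 2"
    and "\<nexists>s::'a. s\<^sup>2 = of_nat q"
  shows "\<not> QuadRes (int q) (int CARD('a))"
proof
  assume *: "QuadRes (int q) (int CARD('a))"
  have "CARD('a) > 2"
    using assms(2) prime_gt_1_nat[OF assms(1)] by (cases "CARD('a) = 2") auto
  \<comment> \<open>Otherwise \<open>q\<close> would be 0 in the field, hence a square.\<close>
  moreover have "CARD('a) \<noteq> q"
    using assms(5) CHAR_eq_CARD[OF assms(1)] of_nat_CHAR[where ?'a = 'a] by (metis power_zero_numeral)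
  ultimately have "QuadRes (int CARD('a)) (int q)"
    by (rule QuadRes_reciprocity[OF assms(1) _ assms(3,4) _ assms(2) *])
  then obtain s :: 'a where "s\<^sup>2 = of_int (int q)"
    using QuadRes_imp_square[OF assms(1)] by blast
  then show False
    using assms(5) by (metis of_int_of_nat_eq)
qed

lemma mod_square_imp_QuadRes:
  assumes "p mod q = n\<^sup>2 mod q"
  shows "QuadRes (int q) (int p)"
proof -
  have "[n\<^sup>2 = p] (mod q)"
    using assms by (simp add: cong_def)
  then have "[(int n)\<^sup>2 = int p] (mod int q)"
    by (metis cong_int_iff of_nat_power)
  then show ?thesis
    unfolding QuadRes_def by blast
qed

subsection \<open>Lucas sequences and powers of Moebius transformations\<close>

text \<open>The Lucas sequence of the first kind for \<open>z\<^sup>2 - P z + Q\<close>. With trace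
  and determinant for \<open>P\<close> and \<open>Q\<close>, it gives the coefficients of the powers
  of a 2 by 2 matrix by Cayley-Hamilton.\<close>

fun lucas :: "'a::comm_ring_1 \<Rightarrow> 'a \<Rightarrow> nat \<Rightarrow> 'a" where
  "lucas P Q 0 = 0"
| "lucas P Q (Suc 0) = 1"
| "lucas P Q (Suc (Suc n)) = P * lucas P Q (Suc n) - Q * lucas P Q n"

text \<open>\<open>[:0, 1:]\<close> plays the role of an eigenvalue and the modulus is the
  characteristic polynomial; each step reduces one square of the indeterminate.\<close>

lemma monom_cong_lucas:
  fixes P Q :: "'a::field"
  shows "[[:0, 1:] ^ Suc n = [:- Q * lucas P Q n, lucas P Q (Suc n):]] (mod [:Q, - P, 1:])"
proof (induction n)
  case 0
  then show ?case by simp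
next
  case (Suc n)
  let ?u = "lucas P Q"
  have "[[:0, 1:] * [:0, 1:] ^ Suc n = [:0, 1:] * [:- Q * ?u n, ?u (Suc n):]] (mod [:Q, - P, 1:])"
    using Suc by (rule cong_scalar_left)
  also have "[:0, 1:] * [:- Q * ?u n, ?u (Suc n):]
      = [:- Q * ?u (Suc n), ?u (Suc (Suc n)):] + [:?u (Suc n):] * [:Q, - P, 1:]"
    by (simp add: algebra_simps)
  also have "[\<dots> = [:- Q * ?u (Suc n), ?u (Suc (Suc n)):]] (mod [:Q, - P, 1:])"
    unfolding cong_def by (rule mod_mult_self1)
  finally show ?case by simp
qed

text \<open>After completing the square, \<open>v\<close> squares to a nonsquare \<open>D\<close>,
  and Euler's criterion gives \<open>v ^ CARD('a) = - v\<close>. Frobenius is thus conjugation, and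
  the left side is the norm \<open>Q\<close> of the indeterminate.\<close>

lemma Frobenius_quadratic:
  fixes P Q :: "'a::{field,finite}"
  assumes "prime CARD('a)" and "CARD('a) > 2" and nsq: "\<nexists>s. s\<^sup>2 = P\<^sup>2 - 4 * Q"
  shows "[[:0, 1:] ^ Suc CARD('a) = [:Q:]] (mod [:Q, - P, 1:])"
proof -
  let ?p = "CARD('a)" and ?q = "(CARD('a) - 1) div 2"
  have two: "(2::'a) \<noteq> 0"
    by (rule odd_CARD_two_neq_0[OF assms(1,2)])
  have "odd ?p"
    using assms prime_odd_nat by blast
  then have p: "?p = Suc (2 * ?q)"
    using assms(2) by simp
  define u where "u = P / 2"
  define D where "D = u\<^sup>2 - Q"
  define v :: "'a poly" where "v = [:- u, 1:]"
  have P: "P = 2 * u"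
    using two by (simp add: u_def)
  have "\<nexists>s. s\<^sup>2 = D"
  proof
    assume "\<exists>s. s\<^sup>2 = D"
    then obtain s where s: "s\<^sup>2 = D" ..
    have "(2 * s)\<^sup>2 = P\<^sup>2 - 4 * Q"
      by (simp add: power_mult_distrib s D_def P right_diff_distrib)
    then show False using nsq by blast
  qed
  then have D: "D ^ ?q = -1"
    by (rule euler_criterion_field[OF assms(1,2)])
  have vv: "v\<^sup>2 = [:D:] + [:Q, - P, 1:]"
    by (simp add: v_def D_def P power2_eq_square)
  have "[v\<^sup>2 = [:D:]] (mod [:Q, - P, 1:])"
    unfolding vv cong_def by (rule mod_add_self2)
  then have "[v * (v\<^sup>2) ^ ?q = v * [:D:] ^ ?q] (mod [:Q, - P, 1:])"
    by (intro cong_scalar_left cong_pow)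
  moreover have "v * (v\<^sup>2) ^ ?q = v ^ ?p"
    by (subst (2) p) (simp flip: power_mult)
  moreover have "v * [:D:] ^ ?q = - v"
    unfolding poly_const_pow D by simp
  ultimately have vp: "[v ^ ?p = - v] (mod [:Q, - P, 1:])"
    by simp
  have "u ^ ?p = u"
    using power_CARD_minus_1[OF assms(1), of u] assms(2) power_minus_mult[of ?p u] by (cases "u = 0") simp_all
  moreover have "(v + [:u:]) ^ ?p = v ^ ?p + [:u:] ^ ?p"
    using assms(1) by (intro freshmans_dream) (simp_all add: CHAR_eq_CARD)
  ultimately have "[:0, 1:] ^ ?p = v ^ ?p + [:u:]"
    by (simp add: v_def poly_const_pow)
  with vp have "[[:0, 1:] ^ ?p = - v + [:u:]] (mod [:Q, - P, 1:])"
    by (metis cong_add_rcancel)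
  then have "[[:0, 1:] * [:0, 1:] ^ ?p = [:0, 1:] * (- v + [:u:])] (mod [:Q, - P, 1:])"
    by (rule cong_scalar_left)
  \<comment> \<open>\<open>- v + [:u:]\<close> is the conjugate root, \<open>P\<close> minus the
    indeterminate.\<close>
  moreover have "[:0, 1:] * (- v + [:u:]) = [:Q:] + (- 1) * [:Q, - P, 1:]"
    by (simp add: v_def P)
  then have "[[:0, 1:] * (- v + [:u:]) = [:Q:]] (mod [:Q, - P, 1:])"
    unfolding cong_def by (simp only: mod_mult_self1)
  ultimately show ?thesis
    using cong_trans by fastforce
qed

text \<open>The \<open>m\<close>-th power of the indeterminate is a constant \<open>c\<close>;
  squaring it and comparing with the Frobenius computation gives
  \<open>Q = c\<^sup>2\<close>.\<close>

lemma lucas_half_Suc_CARD_imp_square: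
  fixes P Q :: "'a::{field,finite}"
  assumes "prime CARD('a)" and "CARD('a) > 2" and "\<nexists>s. s\<^sup>2 = P\<^sup>2 - 4 * Q"
    and m: "2 * m = Suc CARD('a)" and "lucas P Q m = 0"
  shows "\<exists>s. s\<^sup>2 = Q"
proof -
  obtain n where n: "m = Suc n"
    using m by (cases m) auto
  define c where "c = - Q * lucas P Q n"
  have "[[:0, 1:] ^ m = [:c:]] (mod [:Q, - P, 1:])"
    using monom_cong_lucas[where n = n and P = P and Q = Q] assms(5)
    by (simp add: n c_def del: power_Suc)
  then have "[([:0, 1:] ^ m)\<^sup>2 = [:c:]\<^sup>2] (mod [:Q, - P, 1:])"
    by (rule cong_pow)
  moreover have "([:0, 1:] ^ m)\<^sup>2 = [:0, 1:: 'a:] ^ Suc CARD('a)"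
    by (simp only: power_mult[symmetric] mult.commute[of m] m)
  ultimately have "[[:Q:] = [:c\<^sup>2:]] (mod [:Q, - P, 1:])"
    using Frobenius_quadratic[OF assms(1-3)] by (metis cong_sym cong_trans poly_const_pow)
  \<comment> \<open>Constants have smaller degree than the modulus, so congruence means
    equality.\<close>
  then have "[:Q:] = [:c\<^sup>2:]"
    by (simp add: cong_def mod_poly_less)
  then show ?thesis by auto
qed

section \<open>Powers, orders and fixed points of Moebius transformations\<close>

lemma det_neq_0_imp_mobius_id_iff:
  fixes A :: "'a::field ^ 2 ^ 2"
  assumes "det A \<noteq> 0"
  shows "mobius A = id \<longleftrightarrow> A = mat (A $ 1 $ 1)"
proof -
  have "mobius (mat 1 :: 'a ^ 2 ^ 2) = id"
    by (rule ext) (simp add: mobius_def mat_def split: option.split)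
  moreover have "(\<exists>r. r \<noteq> 0 \<and> A = (\<chi> i j. r * mat 1 $ i $ j)) \<longleftrightarrow> A = mat (A $ 1 $ 1)"
    using assms by (auto simp: vec_eq_iff forall_2 mat_def det_2)
  ultimately show ?thesis
    using mobius_eq_iff[OF assms, of "mat 1"] by simp
qed

text \<open>Cayley-Hamilton: \<open>B n\<close> is the matrix power of exponent
  \<open>n + 1\<close>; the shift avoids the index \<open>n - 1\<close> in the Lucas
  sequence.\<close>

lemma mobius_funpow:
  fixes A :: "'a::field ^ 2 ^ 2"
  assumes "det A \<noteq> 0"
  defines "u \<equiv> lucas (trace A) (det A)"
  defines "B \<equiv> \<lambda>n. (\<chi> i j. u (Suc n) * A $ i $ j) - mat (det A * u n)"
  shows "det (B n) \<noteq> 0" and "mobius A ^^ Suc n = mobius (B n)"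
proof -
  have B0: "B 0 = A"
    by (simp add: B_def u_def vec_eq_iff mat_def)
  have BS: "B (Suc n) = A ** B n" for n
    by (simp add: B_def u_def vec_eq_iff forall_2 mat_def matrix_matrix_mult_def sum_2 trace_def det_2
        algebra_simps)
  show det: "det (B n) \<noteq> 0" for n
    by (induction n) (simp_all add: B0 BS det_mul assms(1))
  show "mobius A ^^ Suc n = mobius (B n)"
  proof (induction n)
    case (Suc n)
    have "mobius (B (Suc n)) = mobius A \<circ>> mobius (B n)"
      unfolding BS by (rule mobius_mult[OF assms(1) det])
    then show ?case
      unfolding funpow_Suc_right[of "Suc n"] Suc by (simp add: fcomp_comp)
  qed (simp add: B0)
qed

text \<open>As \<open>A\<close> is not scalar, a combination of \<open>A\<close> and a scalar matrix
  is scalar only if the coefficient of \<open>A\<close> vanishes.\<close>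

lemma mobius_funpow_eq_id_iff:
  fixes A :: "'a::field ^ 2 ^ 2"
  assumes "det A \<noteq> 0" and "mobius A \<noteq> id"
  shows "mobius A ^^ n = id \<longleftrightarrow> lucas (trace A) (det A) n = 0"
proof (cases n)
  case (Suc m)
  let ?u = "lucas (trace A) (det A)"
  let ?B = "(\<chi> i j. ?u (Suc m) * A $ i $ j) - mat (det A * ?u m)"
  have "A \<noteq> mat (A $ 1 $ 1)"
    using assms det_neq_0_imp_mobius_id_iff by blast
  then have "?B = mat (?B $ 1 $ 1) \<longleftrightarrow> ?u (Suc m) = 0"
    by (auto simp: vec_eq_iff forall_2 mat_def)
  then show ?thesis
    using mobius_funpow[OF assms(1), of m] det_neq_0_imp_mobius_id_iff[of ?B] unfolding Suc by metis
qed simp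

text \<open>The second Lucas number is the trace.\<close>

lemma mobius_involution_trace:
  fixes A :: "'a::field ^ 2 ^ 2"
  assumes "det A \<noteq> 0" and "mobius A \<noteq> id" and "mobius A \<circ>> mobius A = id"
  shows "trace A = 0"
  using mobius_funpow_eq_id_iff[OF assms(1,2), of 2] assms(3)
  by (simp add: numeral_2_eq_2 fcomp_comp)

text \<open>Finite fixed points are roots of a quadratic with discriminant
  \<open>(trace A)\<^sup>2 - 4 * det A\<close>. If its leading coefficient vanishes, infinity is
  fixed.\<close>

lemma mobius_fixed_point:
  fixes A :: "'a::field ^ 2 ^ 2"
  assumes "(2::'a) \<noteq> 0" and "det A \<noteq> 0" and "s\<^sup>2 = (trace A)\<^sup>2 - 4 * det A"
  shows "\<exists>u. mobius A u = u"
proof (cases "A $ 1 $ 2 = 0")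
  case True
  then have "mobius A None = None"
    by (simp add: mobius_def)
  then show ?thesis ..
next
  case False
  define a b c d where "a = A $ 1 $ 1" and "b = A $ 1 $ 2" and "c = A $ 2 $ 1" and "d = A $ 2 $ 2"
  have b: "b \<noteq> 0" and det: "a * d - b * c \<noteq> 0" and s: "s\<^sup>2 = (a + d)\<^sup>2 - 4 * (a * d - b * c)"
    using False assms by (simp_all add: a_def b_def c_def d_def det_2 trace_def sum_2)
  define z where "z = (a - d + s) / (2 * b)"
  have z: "2 * b * z = a - d + s"
    using b assms(1) by (simp add: z_def)
  have "4 * b * ((b * z + d) * z - (a * z + c)) = (2 * b * z + d - a)\<^sup>2 - ((a + d)\<^sup>2 - 4 * (a * d - b * c))"
    by (simp add: power2_eq_square algebra_simps)
  also have "\<dots> = 0"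
    unfolding z s[symmetric] by simp
  finally have "2 * 2 * b * ((b * z + d) * z - (a * z + c)) = 0"
    by simp
  then have "(b * z + d) * z - (a * z + c) = 0"
    using b assms(1) unfolding mult_eq_0_iff by blast
  then have root: "a * z + c = z * (b * z + d)"
    by (simp add: mult.commute)
  \<comment> \<open>A root that is a pole would also annihilate the numerator, making
    \<open>A\<close> singular.\<close>
  have "b * z + d \<noteq> 0"
  proof
    assume "b * z + d = 0"
    then have "c = - (a * z)" "d = - (b * z)"
      using root by (simp_all add: eq_neg_iff_add_eq_0 add.commute)
    then show False using det by simp
  qed
  with root have "(a * z + c) / (b * z + d) = z"
    by (simp add: divide_eq_eq)
  with \<open>b * z + d \<noteq> 0\<close> have "mobius A (Some z) = Some z"
    by (simp add: mobius_def Let_def flip: a_def b_def c_def d_def)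
  then show ?thesis ..
qed

subsection \<open>The associate diagram\<close>

text \<open>The off-diagonal 1 stands below the diagonal because matrices act on row vectors from
  the right; this is the matrix of \<open>x \<circ>> y\<close>.\<close>

definition transl :: "'a::field ^ 2 ^ 2" where
  "transl = (\<chi> i j. if i = 1 \<and> j = 2 then 0 else 1)"

lemma transl_nth:
  "transl $ 1 $ 1 = 1" "transl $ 1 $ 2 = 0" "transl $ 2 $ 1 = 1" "transl $ 2 $ 2 = 1"
  by (simp_all add: transl_def)

lemma det_transl: "det transl = 1"
  by (simp add: det_2 transl_nth)

lemma mobius_transl: "mobius transl = map_option (\<lambda>z. z + 1)"
  by (rule ext) (simp add: mobius_def transl_nth split: option.split)

lemma trace_mult_transl: "trace (A ** transl) = trace A + A $ 1 $ 2"
  by (simp add: trace_def sum_2 matrix_matrix_mult_def transl_nth)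

lemma funpow_map_option_plus_1:
  "map_option (\<lambda>z::'a::field. z + 1) ^^ n = map_option (\<lambda>z. z + of_nat n)"
  by (induction n) (auto simp: option.map_comp o_def fun_eq_iff ac_simps option.map_ident)

text \<open>With \<open>t\<close> its own inverse, inverting \<open>g\<close> means that
  \<open>g \<circ>> t\<close> squares to the identity, the form from which a trace is seen to be
  0.\<close>

lemma inverting_involution:
  assumes "bij g" and "t \<circ>> t = id" and "inv_into UNIV t \<circ>> g \<circ>> t = inv_into UNIV g"
  shows "t (g (t (g u))) = u"
proof -
  have "t (t v) = v" for v
    using assms(2) by (metis fcomp_apply id_apply)
  then have "inv_into UNIV t = t"
    by (intro inv_unique_comp) auto
  then have "t (g (t v)) = inv_into UNIV g v" for v
    using assms(3) by (metis fcomp_apply)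
  then show ?thesis
    using assms(1) by (simp add: bij_is_inj)
qed

lemma funpow_card_orbit:
  fixes f :: "'s::finite \<Rightarrow> 's"
  assumes "bij f"
  shows "(f ^^ card (orbit f u)) u = u"
proof -
  have "permutation f"
    using assms by (simp add: permutation)
  then have u: "u \<in> orbit f u"
    by (rule permutation_self_in_orbit)
  then have "card (orbit f u) = funpow_dist1 f u u"
    using card_image[OF inj_on_funpow_dist1[OF u]] orbit_conv_funpow_dist1[OF u] by simp
  then show ?thesis
    using funpow_dist1_prop[OF u] by simp
qed

text \<open>The part common to all \<open>k\<close>. Here \<open>b\<close> is the upper right entry
  of the matrix of \<open>x\<close>, which is also the trace of the matrix of \<open>y\<close>; it
  alone decides the order of \<open>y\<close> and, up to squares, the discriminant of
  \<open>x \<circ>> t \<circ>> y\<close>.\<close>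

lemma januarial_associate:
  fixes x y t :: "'a::{field,finite} option \<Rightarrow> 'a option"
  assumes p: "prime CARD('a)" and p3: "CARD('a) > 3" and k: "k > 2" "\<not> CARD('a) dvd k"
    and "x \<in> PSL2"
    and act: "triangle_action k CARD('a) x y"
    and ord: "\<And>n. 0 < n \<Longrightarrow> n < k \<Longrightarrow> y ^^ n \<noteq> id"
    and xy: "x \<circ>> y = map_option (\<lambda>z. z + 1)"
    and "t \<in> PGL2" and t: "t \<noteq> id" "t ^^ 2 = id"
    and tx: "inv_into UNIV t \<circ>> x \<circ>> t = inv_into UNIV x"
    and ty: "inv_into UNIV t \<circ>> y \<circ>> t = inv_into UNIV y"
    and jan: "januarial k (x \<circ>> t) y"
  shows "\<exists>(b::'a) (i::'a). (\<forall>n. y ^^ n = id \<longleftrightarrow> lucas b 1 n = 0) \<and> i\<^sup>2 = -1 \<and> (\<nexists>s. s\<^sup>2 = b\<^sup>2 + 4)"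
proof -
  have two: "(2::'a) \<noteq> 0"
    using p p3 by (intro odd_CARD_two_neq_0) auto
  obtain X where X: "det X = 1" "x = mobius X"
    using \<open>x \<in> PSL2\<close> by (auto simp: PSL2_def)
  obtain M where M: "det M \<noteq> 0" "t = mobius M"
    using \<open>t \<in> PGL2\<close> by (auto simp: PGL2_def)
  have bx: "bij x" and "bij y" and "x ^^ 2 = id" and yk: "y ^^ k = id"
    using act by (auto simp: triangle_action_def)
  then have xx: "x \<circ>> x = id" and tt: "t \<circ>> t = id"
    using t(2) by (simp_all add: numeral_2_eq_2 fcomp_comp)
  have tt': "t (t u) = u" and xx': "x (x u) = u" for u
    using tt xx by (metis fcomp_apply id_apply)+
  have y1: "y \<noteq> id" and y2: "y ^^ 2 \<noteq> id"
    using ord[of 1] ord[of 2] k by auto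
  \<comment> \<open>Otherwise \<open>y\<close> would be a translation, whose order
    \<open>CARD('a)\<close> does not divide \<open>k\<close>.\<close>
  have "x \<noteq> id"
  proof
    assume "x = id"
    then have "y = map_option (\<lambda>z. z + 1)"
      using xy by simp
    then have "map_option (\<lambda>z. z + of_nat k) (Some (0::'a)) = Some 0"
      using yk by (simp add: funpow_map_option_plus_1)
    then show False
      using k(2) CHAR_eq_CARD[OF p] by (simp add: of_nat_eq_0_iff_char_dvd)
  qed
  \<comment> \<open>As \<open>x\<close> is an involution, \<open>y\<close> is \<open>x\<close>
    followed by the translation.\<close>
  have y: "y = mobius (X ** transl)"
    using xy xx' by (auto simp: mobius_mult X det_transl mobius_transl fun_eq_iff) metis
  define a b c where "a = X $ 1 $ 1" and "b = X $ 1 $ 2" and "c = X $ 2 $ 1"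
  have "trace X = 0"
    using mobius_involution_trace[of X] X \<open>x \<noteq> id\<close> xx by simp
  then have X22: "X $ 2 $ 2 = - a"
    by (simp add: trace_def sum_2 a_def eq_neg_iff_add_eq_0 add.commute)
  have abc: "- (a * a) - b * c = 1"
    using X(1) X22 by (simp add: det_2 a_def b_def c_def)
  have yn: "y ^^ n = id \<longleftrightarrow> lucas b 1 n = 0" for n
    using mobius_funpow_eq_id_iff[of "X ** transl" n] y y1 \<open>trace X = 0\<close>
    by (simp add: det_mul X(1) det_transl trace_mult_transl b_def)
  have "b \<noteq> 0"
    using yn[of 2] y2 by (auto simp: numeral_2_eq_2)
  define \<alpha> \<beta> \<gamma> where "\<alpha> = M $ 1 $ 1" and "\<beta> = M $ 1 $ 2" and "\<gamma> = M $ 2 $ 1"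
  have "trace M = 0"
    using mobius_involution_trace[of M] M t(1) tt by simp
  then have M22: "M $ 2 $ 2 = - \<alpha>"
    by (simp add: trace_def sum_2 \<alpha>_def eq_neg_iff_add_eq_0 add.commute)
  note xt = inverting_involution[OF bx tt tx] and yt = inverting_involution[OF \<open>bij y\<close> tt ty]
  \<comment> \<open>Otherwise \<open>t = x\<close> inverts \<open>y\<close>, so the square of the
    translation would be trivial, although 2 is not 0.\<close>
  have "x \<circ>> t \<noteq> id"
  proof
    assume "x \<circ>> t = id"
    then have "t = x"
      using tt' by (metis fcomp_apply id_apply ext)
    then have "(x \<circ>> y) ((x \<circ>> y) u) = u" for u
      using yt xx' by (metis fcomp_apply)
    from this[of "Some 0"] show False
      using two unfolding xy by simp
  qed
  then have "trace (X ** M) = 0"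
    using mobius_involution_trace[of "X ** M"] X M xt
    by (simp add: det_mul mobius_mult fun_eq_iff)
  then have E1: "2 * a * \<alpha> + b * \<gamma> + c * \<beta> = 0"
    using X22 M22
    by (simp add: trace_def sum_2 matrix_matrix_mult_def a_def b_def c_def
        \<alpha>_def \<beta>_def \<gamma>_def algebra_simps)
  have "y \<circ>> t \<noteq> id"
  proof
    assume "y \<circ>> t = id"
    then have "t = y"
      using tt' by (metis fcomp_apply id_apply ext)
    then show False
      using t(2) y2 by simp
  qed
  then have "trace (X ** transl ** M) = 0"
    using mobius_involution_trace[of "X ** transl ** M"] X(1) M y yt
    by (simp add: det_mul mobius_mult det_transl fun_eq_iff)
  then have "b * \<alpha> + (2 * a * \<alpha> + b * \<gamma> + c * \<beta>) = a * \<beta>"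
    using X22 M22
    by (simp add: trace_def sum_2 matrix_matrix_mult_def transl_nth a_def b_def c_def
        \<alpha>_def \<beta>_def \<gamma>_def algebra_simps)
  then have E2: "b * \<alpha> = a * \<beta>"
    unfolding E1 by simp
  define w where "w = x \<circ>> t \<circ>> y"
  define \<delta> where "\<delta> = det M"
  \<comment> \<open>\<open>x \<circ>> t\<close> is an involution, so \<open>x\<close> and
    \<open>t\<close> commute; this brings \<open>x\<close> next to \<open>y\<close>.\<close>
  have "x (t u) = t (x u)" for u
    using xt[of "x u"] xx' tt' by metis
  then have "w = t \<circ>> (x \<circ>> y)"
    by (simp add: w_def fun_eq_iff)
  then have w: "w = mobius (M ** transl)"
    by (simp add: xy M mobius_mult det_transl mobius_transl)
  have W: "trace (M ** transl) = \<beta>" "det (M ** transl) = \<delta>"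
    using \<open>trace M = 0\<close> by (simp_all add: trace_mult_transl \<beta>_def det_mul det_transl \<delta>_def)
  \<comment> \<open>The factor \<open>b\<^sup>2\<close> lets the two trace equations eliminate
    \<open>\<alpha>\<close> and \<open>\<gamma>\<close>; what remains is
    \<open>det X = 1\<close>.\<close>
  have "b\<^sup>2 * \<delta> = - (b * \<alpha>)\<^sup>2 - b * \<beta> * (b * \<gamma>)"
    using M22 by (simp add: \<delta>_def det_2 \<alpha>_def \<beta>_def \<gamma>_def power2_eq_square algebra_simps)
  also have "b * \<gamma> = - (2 * a * \<alpha> + c * \<beta>)"
    using E1 unfolding eq_neg_iff_add_eq_0 by (simp only: ac_simps)
  also have "- (b * \<alpha>)\<^sup>2 - b * \<beta> * - (2 * a * \<alpha> + c * \<beta>)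
      = - (b * \<alpha>)\<^sup>2 + 2 * a * \<beta> * (b * \<alpha>) + b * c * \<beta>\<^sup>2"
    by (simp add: power2_eq_square algebra_simps)
  also have "\<dots> = - (- (a * a) - b * c) * \<beta>\<^sup>2"
    unfolding E2 by (simp add: power2_eq_square algebra_simps)
  finally have \<delta>: "b\<^sup>2 * \<delta> = - \<beta>\<^sup>2"
    unfolding abc by simp
  then have "\<beta> \<noteq> 0"
    using M(1) \<open>b \<noteq> 0\<close> by (auto simp: \<delta>_def)

  have bw: "bij w"
    using jan unfolding januarial_def triangle_action_def w_def fcomp_comp by (auto intro: bij_comp)
  have orb: "2 * card (orbit w u) = Suc CARD('a)" for u
    using jan by (auto simp: januarial_def w_def card_UNIV_option)
  have nofix: "w u \<noteq> u" for u
  proof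
    assume "w u = u"
    then have "orbit w u = {u}"
      by (simp add: orbit_eq_singleton_iff)
    then show False
      using orb[of u] p3 by simp
  qed
  then have nsq: "\<nexists>s. s\<^sup>2 = \<beta>\<^sup>2 - 4 * \<delta>"
    using mobius_fixed_point[OF two, of "M ** transl"] M(1) w W by (metis \<delta>_def)
  obtain m where m: "2 * m = Suc CARD('a)"
    using orb by blast
  \<comment> \<open>All orbits have the same length \<open>m\<close>, so the \<open>m\<close>-th
    power fixes every point.\<close>
  then have "w ^^ m = id"
    using funpow_card_orbit[OF bw] orb by (metis ext id_apply mult_left_cancel zero_neq_numeral)
  moreover have "w \<noteq> id"
    using nofix by (metis id_apply)
  ultimately have "lucas \<beta> \<delta> m = 0"
    using mobius_funpow_eq_id_iff[of "M ** transl" m] M(1) w W by (simp add: \<delta>_def)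
  then obtain r where r: "r\<^sup>2 = \<delta>"
    using lucas_half_Suc_CARD_imp_square[OF p _ nsq m] p3 by auto
  have "(r * b / \<beta>)\<^sup>2 = -1"
    using \<delta> \<open>\<beta> \<noteq> 0\<close> by (simp add: power_divide power_mult_distrib r mult.commute)
  moreover have "\<nexists>s. s\<^sup>2 = b\<^sup>2 + 4"
  proof
    assume "\<exists>s. s\<^sup>2 = b\<^sup>2 + 4"
    then obtain s where s: "s\<^sup>2 = b\<^sup>2 + 4" ..
    have "b\<^sup>2 * (\<beta> * s / b)\<^sup>2 = \<beta>\<^sup>2 * s\<^sup>2"
      using \<open>b \<noteq> 0\<close> by (simp add: power_divide power_mult_distrib)
    also have "\<dots> = b\<^sup>2 * \<beta>\<^sup>2 - 4 * (- \<beta>\<^sup>2)"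
      unfolding s by (simp add: algebra_simps)
    also have "\<dots> = b\<^sup>2 * (\<beta>\<^sup>2 - 4 * \<delta>)"
      unfolding \<delta>[symmetric] by (simp add: algebra_simps)
    finally have "(\<beta> * s / b)\<^sup>2 = \<beta>\<^sup>2 - 4 * \<delta>"
      using \<open>b \<noteq> 0\<close> by simp
    then show False using nsq by blast
  qed
  ultimately show ?thesis using yn by blast
qed

section \<open>The congruences for \<open>p\<close> when \<open>k\<close> is 3, 4 or 6\<close>

theorem corollary4p11:
  fixes p k :: nat
    and x y t :: "'a::{field,finite} option \<Rightarrow> 'a option"
  assumes "prime p" and "p > 3" and "k > 0"
    and "CARD('a) = p"
    and "x \<in> PSL2" and "y \<in> PSL2"
    and "triangle_action k p x y"
    and "\<forall>n. 0 < n \<and> n < k \<longrightarrow> y ^^ n \<noteq> id"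
    and "x \<circ>> y = map_option (\<lambda>z. z + 1)"
    and "t \<in> PGL2" and "t \<noteq> id" and "t ^^ 2 = id"
    and "inv_into UNIV t \<circ>> x \<circ>> t = inv_into UNIV x"
    and "inv_into UNIV t \<circ>> y \<circ>> t = inv_into UNIV y"
    and "januarial_for (if t \<in> PSL2 then PSL2 else PGL2) k (x \<circ>> t) y"
  shows "(k = 3 \<longrightarrow> [p = 13] (mod 20) \<or> [p = 17] (mod 20))
    \<and> (k = 4 \<longrightarrow> [p = 17] (mod 24) \<or> [p = 19] (mod 24))
    \<and> (k = 6 \<longrightarrow> [p = 13] (mod 42) \<or> [p = 19] (mod 42) \<or> [p = 31] (mod 42))"
proof -
  have p: "prime CARD('a)" "CARD('a) > 2" "CARD('a) > 3"
    using assms(1,2,4) by auto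
  have yk: "y ^^ k = id"
    using assms(7) by (simp add: triangle_action_def)
  have main: "\<exists>(b::'a) (i::'a). (\<forall>n. y ^^ n = id \<longleftrightarrow> lucas b 1 n = 0) \<and> i\<^sup>2 = -1 \<and> (\<nexists>s. s\<^sup>2 = b\<^sup>2 + 4)"
    if "k \<in> {3, 4, 6}"
  proof (rule januarial_associate)
    \<comment> \<open>All three values divide 12, whose prime factors are at most 3.\<close>
    show "\<not> CARD('a) dvd k"
    proof
      assume "CARD('a) dvd k"
      then have "CARD('a) dvd 2 * 2 * 3"
        using that by (auto intro: dvd_trans)
      then have "CARD('a) dvd 2 \<or> CARD('a) dvd 3"
        using p(1) by (metis prime_dvd_mult_nat)
      then show False
        using p by (auto dest: dvd_imp_le)
    qed
    show "januarial k (x \<circ>> t) y"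
      using assms(15) by (simp add: januarial_for_def)
  qed (use that p assms in auto)
  have "[p = 13] (mod 20) \<or> [p = 17] (mod 20)" if k: "k = 3"
  proof -
    obtain b i :: 'a where b: "lucas b 1 3 = 0" and i: "i\<^sup>2 = -1" and nsq: "\<nexists>s. s\<^sup>2 = b\<^sup>2 + 4"
      using main yk k by blast
    \<comment> \<open>\<open>lucas b 1 3\<close> is \<open>b\<^sup>2 - 1\<close>.\<close>
    have "b\<^sup>2 = 1"
      using b by (simp add: numeral_3_eq_3 power2_eq_square)
    then have "\<nexists>s::'a. s\<^sup>2 = of_nat 5"
      using nsq by simp
    moreover have p4: "p mod 4 = 1"
      using minus_1_square_imp[OF p(1,2) i] assms(4) by simp
    ultimately have "\<not> QuadRes (int 5) (int p)"
      using nonsquare_imp_not_QuadRes[where ?'a = 'a, of 5] p(1) assms(4) by simp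
    then have "p mod 5 \<noteq> n\<^sup>2 mod 5" for n
      using mod_square_imp_QuadRes by blast
    from this[of 0] this[of 1] this[of 2] have "p mod 5 \<notin> {0, 1, 4}"
      by simp
    \<comment> \<open>The residues modulo 4 and 5 fix the class modulo 20, so a check of one period
      suffices.\<close>
    moreover have "\<forall>r\<in>{..<20::nat}. r mod 4 = 1 \<longrightarrow> r mod 5 \<notin> {0, 1, 4} \<longrightarrow> r \<in> {13, 17}"
      by code_simp
    ultimately have "p mod 20 \<in> {13, 17}"
      using p4 mod_mod_cancel[of 4 20 p] mod_mod_cancel[of 5 20 p] by simp
    then show ?thesis
      by (simp add: cong_def)
  qed
  moreover have "[p = 17] (mod 24) \<or> [p = 19] (mod 24)" if k: "k = 4"
  proof -
    obtain b i :: 'a where b: "\<And>n. y ^^ n = id \<longleftrightarrow> lucas b 1 n = 0" and i: "i\<^sup>2 = -1"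
      and nsq: "\<nexists>s. s\<^sup>2 = b\<^sup>2 + 4"
      using main k by blast
    have "lucas b 1 4 = 0" "lucas b 1 2 \<noteq> 0"
      using b[of 4] b[of 2] yk k assms(8) by simp_all
    moreover have "lucas b 1 4 = b * (b\<^sup>2 - 2)" "lucas b 1 2 = b"
      by (simp_all add: eval_nat_numeral algebra_simps)
    \<comment> \<open>The factor \<open>b\<close> is excluded by
      \<open>y ^^ 2 \<noteq> id\<close>.\<close>
    ultimately have b2: "b\<^sup>2 = 2"
      by auto
    have p8: "p mod 8 = 1"
      using two_square_imp_mod_8[OF p(1,2) b2 i] assms(4) by simp
    \<comment> \<open>As \<open>b\<^sup>2 = 2\<close>, a root of 3 would yield one of
      \<open>b\<^sup>2 + 4\<close>, which is 6.\<close>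
    have "\<nexists>s::'a. s\<^sup>2 = of_nat 3"
    proof
      assume "\<exists>s::'a. s\<^sup>2 = of_nat 3"
      then obtain s :: 'a where "s\<^sup>2 = 3" by auto
      then have "(b * s)\<^sup>2 = b\<^sup>2 + 4"
        by (simp add: power_mult_distrib b2)
      then show False using nsq by blast
    qed
    moreover have "p mod 4 = 1"
      using p8 by presburger
    ultimately have "\<not> QuadRes (int 3) (int p)"
      using nonsquare_imp_not_QuadRes[where ?'a = 'a, of 3] p(1) assms(4) by simp
    then have "p mod 3 \<noteq> n\<^sup>2 mod 3" for n
      using mod_square_imp_QuadRes by blast
    from this[of 0] this[of 1] have "p mod 3 \<notin> {0, 1}"
      by simp
    moreover have "\<forall>r\<in>{..<24::nat}. r mod 8 = 1 \<longrightarrow> r mod 3 \<notin> {0, 1} \<longrightarrow> r \<in> {17}"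
      by code_simp
    \<comment> \<open>With \<open>p mod 8 = 1\<close>, only the first of the two classes
      remains.\<close>
    ultimately have "p mod 24 \<in> {17}"
      using p8 mod_mod_cancel[of 8 24 p] mod_mod_cancel[of 3 24 p] by simp
    then show ?thesis
      by (simp add: cong_def)
  qed
  moreover have "[p = 13] (mod 42) \<or> [p = 19] (mod 42) \<or> [p = 31] (mod 42)" if k: "k = 6"
  proof -
    obtain b i :: 'a where b: "\<And>n. y ^^ n = id \<longleftrightarrow> lucas b 1 n = 0" and i: "i\<^sup>2 = -1"
      and nsq: "\<nexists>s. s\<^sup>2 = b\<^sup>2 + 4"
      using main k by blast
    have "lucas b 1 6 = 0" "lucas b 1 2 \<noteq> 0" "lucas b 1 3 \<noteq> 0"
      using b[of 6] b[of 2] b[of 3] yk k assms(8) by simp_all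
    moreover have "lucas b 1 6 = b * (b\<^sup>2 - 1) * (b\<^sup>2 - 3)" "lucas b 1 2 = b" "lucas b 1 3 = b\<^sup>2 - 1"
      by (simp_all add: eval_nat_numeral algebra_simps)
    \<comment> \<open>The factors belonging to the orders 2 and 3 are excluded because
      \<open>y\<close> has order 6.\<close>
    ultimately have b2: "b\<^sup>2 = 3"
      by auto
    have p3: "p mod 3 = 1"
      using three_square_imp_mod_3[OF p(1,3) b2 i] assms(4) by simp
    have "\<nexists>s::'a. s\<^sup>2 = of_nat 7"
      using nsq b2 by simp
    moreover have p4: "p mod 4 = 1"
      using minus_1_square_imp[OF p(1,2) i] assms(4) by simp
    moreover have "prime (7::nat)"
      by simp
    ultimately have "\<not> QuadRes (int 7) (int p)"
      using nonsquare_imp_not_QuadRes[where ?'a = 'a, of 7] p(1) assms(4) by simp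
    then have "p mod 7 \<noteq> n\<^sup>2 mod 7" for n
      using mod_square_imp_QuadRes by blast
    \<comment> \<open>The argument 3 accounts for the residue 2, since 9 is 2 modulo 7.\<close>
    from this[of 0] this[of 1] this[of 2] this[of 3] have "p mod 7 \<notin> {0, 1, 2, 4}"
      by simp
    moreover have "p mod 2 = 1"
      using p4 by presburger
    moreover have "\<forall>r\<in>{..<42::nat}. r mod 2 = 1 \<longrightarrow> r mod 3 = 1 \<longrightarrow> r mod 7 \<notin> {0, 1, 2, 4} \<longrightarrow> r \<in> {13, 19, 31}"
      by code_simp
    ultimately have "p mod 42 \<in> {13, 19, 31}"
      using p3 mod_mod_cancel[of 2 42 p] mod_mod_cancel[of 3 42 p] mod_mod_cancel[of 7 42 p] by simp
    then show ?thesis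
      by (simp add: cong_def)
  qed
  ultimately show ?thesis by blast
qed

end
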